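(* Let $G$, $H$, $K$ be finite groups, let $R$ be a commutative ring such that $|H|$ is invertible in $R$, and let $L\le G\times H$ and $M\le H\times K$ be subgroups. Then $L\,\tilde{*}_H^\kappa\,M$ is an $R$-linear combination of subgroups $N\le G\times K$ satisfying $p_1(N)=p_1(L)$ and $p_2(N)=p_2(M)$. Moreover, if $p_2(L)\ne p_1(M)$ then $L\,\tilde{*}_H^\kappa\,M=0$.
   Context: For a finite group $X$, $\mathscr{S}_X$ is the set of subgroups of $X$ and $R\mathscr{S}_X$ is the free $R$-module with basis $\mathscr{S}_X$. For $L\le G\times H$, $p_1(L)\le G$ and $p_2(L)\le H$ are the images of $L$ under the two projections, $k_1(L)=\{g\in G\mid(g,1)\in L\}$ and $k_2(L)=\{h\in H\mid(1,h)\in L\}$. For $L\le G\times H$ and $M\le H\times K$ put $L*M=\{(g,k)\in G\times K\mid\exists\,h\in H:\ (g,h)\in L,\ (h,k)\in M\}$ and $\kappa(L,M)=\frac{|k_2(L)\cap k_1(M)|}{|H|}\in R$. The $R$-bilinear map $-\tilde{*}_H^\kappa-\colon R\mathscr{S}_{G\times H}\times R\mathscr{S}_{H\times K}\to R\mathscr{S}_{G\times K}$ is defined by $$L\,\tilde{*}_H^\kappa\,M=\sum_{N\le G\times K}a_N^{L,M}\cdot N,\qquad a_N^{L,M}:=\sum_{\substack{(L',M')\le(L,M)\\ N\le L'*M'}}\mu_{(L',M'),(L,M)}\cdot\kappa(L',M'),$$ where $\mu$ is the Möbius function of the poset $\mathscr{S}_{G\times H}\times\mathscr{S}_{H\times K}$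 with $(L',M')\le(L,M)$ iff $L'\le L$ and $M'\le M$ (so $\mu_{x,y}=0$ if $x\not\le y$, and $\sum_{x\le z\le y}\mu_{x,z}=\delta_{x,y}$ if $x\le y$). *)

theory Defs
  imports "HOL-Algebra.Coset" "HOL-Algebra.Module" "HOL-Library.Product_Order"
begin

text \<open>The recursion gives up (returning 0) on infinite \<open>P\<close>; for finite \<open>P\<close> the
  lemmas \<open>moebius_not_le\<close> and \<open>sum_moebius\<close> below are the usual characterization.\<close>

function moebius :: "'x::order set \<Rightarrow> 'x \<Rightarrow> 'x \<Rightarrow> int" where
  "moebius P x y =
    (if x = y then 1
     else if finite P \<and> x < y then - (\<Sum>z\<in>{z\<in>P. x \<le> z \<and> z < y}. moebius P x z)
     else 0)"
  by pat_completeness auto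
termination
proof (relation "measure (\<lambda>(P, x, y). card {w\<in>P. w < y})")
  fix P and x y z :: "'x::order"
  assume "finite P \<and> x < y" "z \<in> {z\<in>P. x \<le> z \<and> z < y}"
  then have "finite {w\<in>P. w < y}" "{w\<in>P. w < z} \<subset> {w\<in>P. w < y}"
    by auto
  then show "((P, x, z), (P, x, y)) \<in> measure (\<lambda>(P, x, y). card {w\<in>P. w < y})"
    by (simp add: psubset_card_mono)
qed simp

declare moebius.simps [simp del]

lemma moebius_not_le: "\<not> x \<le> y \<Longrightarrow> moebius P x y = 0"
  by (subst moebius.simps) auto

lemma sum_moebius:
  assumes "finite P" "x \<in> P" "y \<in> P" "x \<le> y"
  shows "(\<Sum>z\<in>{z\<in>P. x \<le> z \<and> z \<le> y}. moebius P x z) = (if x = y then 1 else 0)"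
proof (cases "x = y")
  case True
  have "{z\<in>P. y \<le> z \<and> z \<le> y} = {y}" using assms by auto
  then show ?thesis using True by (simp add: moebius.simps)
next
  case False
  then have "x < y" using assms by simp
  have *: "{z\<in>P. x \<le> z \<and> z \<le> y} = insert y {z\<in>P. x \<le> z \<and> z < y}"
    using assms by auto
  have "(\<Sum>z\<in>{z\<in>P. x \<le> z \<and> z \<le> y}. moebius P x z)
      = moebius P x y + (\<Sum>z\<in>{z\<in>P. x \<le> z \<and> z < y}. moebius P x z)"
    unfolding * using assms by (subst sum.insert) auto
  also have "\<dots> = 0"
    using assms False \<open>x < y\<close> by (subst moebius.simps) simp
  finally show ?thesis using False by simp
qed

definition subgroups_of :: "('a, 'm) monoid_scheme \<Rightarrow> 'a set set" where
  "subgroups_of G = {L. subgroup L G}"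

text \<open>The ring multiplication and unit carried by the \<open>module\<close> record play no role here.\<close>

definition free_module :: "('r, 'm) ring_scheme \<Rightarrow> 'b set \<Rightarrow> ('r, 'b \<Rightarrow> 'r) module" where
  "free_module R B =
    \<lparr>carrier = {f \<in> B \<rightarrow>\<^sub>E carrier R. finite {b\<in>B. f b \<noteq> \<zero>\<^bsub>R\<^esub>}},
     monoid.mult = undefined,
     one = undefined,
     zero = (\<lambda>b\<in>B. \<zero>\<^bsub>R\<^esub>),
     add = (\<lambda>f g. \<lambda>b\<in>B. f b \<oplus>\<^bsub>R\<^esub> g b),
     smult = (\<lambda>r f. \<lambda>b\<in>B. r \<otimes>\<^bsub>R\<^esub> f b)\<rparr>"

definition free_basis :: "('r, 'm) ring_scheme \<Rightarrow> 'b set \<Rightarrow> 'b \<Rightarrow> 'b \<Rightarrow> 'r" where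
  "free_basis R B x = (\<lambda>b\<in>B. if b = x then \<one>\<^bsub>R\<^esub> else \<zero>\<^bsub>R\<^esub>)"

lemma free_module_module:
  fixes R (structure)
  assumes "cring R"
  shows "module R (free_module R B)"
proof -
  interpret cring R by fact
  let ?F = "free_module R B"
  have val: "f b \<in> carrier R" if "f \<in> carrier ?F" "b \<in> B" for f b
    using that by (auto simp: free_module_def)
  have ext: "f = g" if "f \<in> carrier ?F" "g \<in> carrier ?F" "\<And>b. b \<in> B \<Longrightarrow> f b = g b" for f g
    using that by (intro PiE_ext[of f B "\<lambda>_. carrier R"]) (auto simp: free_module_def)
  have add_closed: "f \<oplus>\<^bsub>?F\<^esub> g \<in> carrier ?F" if "f \<in> carrier ?F" "g \<in> carrier ?F" for f g
  proof -
    have "finite ({b\<in>B. f b \<noteq> \<zero>} \<union> {b\<in>B. g b \<noteq> \<zero>})"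
      using that by (auto simp: free_module_def)
    then have "finite {b\<in>B. f b \<oplus> g b \<noteq> \<zero>}"
      by (rule rev_finite_subset) auto
    then show ?thesis
      using that val[OF that(1)] val[OF that(2)] by (auto simp: free_module_def cong: conj_cong)
  qed
  have smult_closed: "r \<odot>\<^bsub>?F\<^esub> f \<in> carrier ?F" if "r \<in> carrier R" "f \<in> carrier ?F" for r f
  proof -
    have "finite {b\<in>B. f b \<noteq> \<zero>}"
      using that by (auto simp: free_module_def)
    then have "finite {b\<in>B. r \<otimes> f b \<noteq> \<zero>}"
      by (rule rev_finite_subset) (use that in auto)
    then show ?thesis
      using that val[OF that(2)] by (auto simp: free_module_def cong: conj_cong)
  qed
  have zero_closed: "\<zero>\<^bsub>?F\<^esub> \<in> carrier ?F"
    by (auto simp: free_module_def cong: conj_cong)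
  have add_app: "(f \<oplus>\<^bsub>?F\<^esub> g) b = f b \<oplus> g b"
    and smult_app: "(r \<odot>\<^bsub>?F\<^esub> f) b = r \<otimes> f b"
    and zero_app: "\<zero>\<^bsub>?F\<^esub> b = \<zero>" if "b \<in> B" for f g r b
    using that by (auto simp: free_module_def)
  note app = add_app smult_app zero_app
  have "abelian_group ?F"
  proof (rule abelian_groupI)
    fix f assume f: "f \<in> carrier ?F"
    show "\<exists>g\<in>carrier ?F. g \<oplus>\<^bsub>?F\<^esub> f = \<zero>\<^bsub>?F\<^esub>"
    proof (rule bexI[of _ "(\<ominus> \<one>) \<odot>\<^bsub>?F\<^esub> f"])
      show "(\<ominus> \<one>) \<odot>\<^bsub>?F\<^esub> f \<oplus>\<^bsub>?F\<^esub> f = \<zero>\<^bsub>?F\<^esub>"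
        by (rule ext) (use f in \<open>auto intro!: add_closed smult_closed zero_closed
            simp: app val l_minus l_neg\<close>)
    qed (use f smult_closed in auto)
  qed (auto intro!: ext add_closed smult_closed zero_closed simp: app val a_ac)
  then show ?thesis
    by (intro moduleI cring_axioms)
      (auto intro!: ext add_closed smult_closed simp: app val l_distr r_distr m_assoc)
qed

lemma free_basis_closed:
  assumes "cring R"
  shows "free_basis R B x \<in> carrier (free_module R B)"
proof -
  interpret cring R by fact
  have "finite {b\<in>B. (if b = x then \<one>\<^bsub>R\<^esub> else \<zero>\<^bsub>R\<^esub>) \<noteq> \<zero>\<^bsub>R\<^esub>}"
    by (rule finite_subset[of _ "{x}"]) auto
  then show ?thesis
    by (auto simp: free_module_def free_basis_def cong: conj_cong)
qed

abbreviation p1 :: "('a \<times> 'b) set \<Rightarrow> 'a set" where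
  "p1 L \<equiv> fst ` L"

abbreviation p2 :: "('a \<times> 'b) set \<Rightarrow> 'b set" where
  "p2 L \<equiv> snd ` L"

definition k1 ::
  "('a, 'm) monoid_scheme \<Rightarrow> ('b, 'n) monoid_scheme \<Rightarrow> ('a \<times> 'b) set \<Rightarrow> 'a set" where
  "k1 G H L = {g \<in> carrier G. (g, \<one>\<^bsub>H\<^esub>) \<in> L}"

definition k2 ::
  "('a, 'm) monoid_scheme \<Rightarrow> ('b, 'n) monoid_scheme \<Rightarrow> ('a \<times> 'b) set \<Rightarrow> 'b set" where
  "k2 G H L = {h \<in> carrier H. (\<one>\<^bsub>G\<^esub>, h) \<in> L}"

text \<open>Below, the product \<open>L * M\<close> of subgroups is the relational composition \<open>L O M\<close>,
  and integers act on (and are mapped to) a ring via \<open>[n] \<cdot> r\<close>.\<close>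

definition kappa ::
  "('r, 's) ring_scheme \<Rightarrow> ('a, 'm) monoid_scheme \<Rightarrow> ('b, 'n) monoid_scheme \<Rightarrow>
    ('c, 'k) monoid_scheme \<Rightarrow> ('a \<times> 'b) set \<Rightarrow> ('b \<times> 'c) set \<Rightarrow> 'r" where
  "kappa R G H K L M =
    ([card (k2 G H L \<inter> k1 H K M)] \<cdot>\<^bsub>R\<^esub> \<one>\<^bsub>R\<^esub>) \<otimes>\<^bsub>R\<^esub> inv\<^bsub>R\<^esub> ([order H] \<cdot>\<^bsub>R\<^esub> \<one>\<^bsub>R\<^esub>)"

text \<open>The order on pairs is the componentwise one from \<open>Product_Order\<close>.\<close>

definition kappa_coeff ::
  "('r, 's) ring_scheme \<Rightarrow> ('a, 'm) monoid_scheme \<Rightarrow> ('b, 'n) monoid_scheme \<Rightarrow>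
    ('c, 'k) monoid_scheme \<Rightarrow> ('a \<times> 'b) set \<Rightarrow> ('b \<times> 'c) set \<Rightarrow> ('a \<times> 'c) set \<Rightarrow> 'r" where
  "kappa_coeff R G H K L M N =
    (let P = subgroups_of (G \<times>\<times> H) \<times> subgroups_of (H \<times>\<times> K) in
      finsum R (\<lambda>(L', M'). [moebius P (L', M') (L, M)] \<cdot>\<^bsub>R\<^esub> kappa R G H K L' M')
        {(L', M')\<in>P. (L', M') \<le> (L, M) \<and> N \<subseteq> L' O M'})"

definition kappa_star_basis ::
  "('r, 's) ring_scheme \<Rightarrow> ('a, 'm) monoid_scheme \<Rightarrow> ('b, 'n) monoid_scheme \<Rightarrow>
    ('c, 'k) monoid_scheme \<Rightarrow> ('a \<times> 'b) set \<Rightarrow> ('b \<times> 'c) set \<Rightarrow> ('a \<times> 'c) set \<Rightarrow> 'r" where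
  "kappa_star_basis R G H K L M =
    (let B = subgroups_of (G \<times>\<times> K); F = free_module R B in
      \<Oplus>\<^bsub>F\<^esub>N\<in>B. kappa_coeff R G H K L M N \<odot>\<^bsub>F\<^esub> free_basis R B N)"

definition kappa_star ::
  "('r, 's) ring_scheme \<Rightarrow> ('a, 'm) monoid_scheme \<Rightarrow> ('b, 'n) monoid_scheme \<Rightarrow>
    ('c, 'k) monoid_scheme \<Rightarrow> (('a \<times> 'b) set \<Rightarrow> 'r) \<Rightarrow> (('b \<times> 'c) set \<Rightarrow> 'r) \<Rightarrow>
    ('a \<times> 'c) set \<Rightarrow> 'r" where
  "kappa_star R G H K x y =
    (let F = free_module R (subgroups_of (G \<times>\<times> K)) in
      \<Oplus>\<^bsub>F\<^esub>L\<in>subgroups_of (G \<times>\<times> H). \<Oplus>\<^bsub>F\<^esub>M\<in>subgroups_of (H \<times>\<times> K).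
        (x L \<otimes>\<^bsub>R\<^esub> y M) \<odot>\<^bsub>F\<^esub> kappa_star_basis R G H K L M)"

lemma kappa_closed:
  assumes "cring R" "[order H] \<cdot>\<^bsub>R\<^esub> \<one>\<^bsub>R\<^esub> \<in> Units R"
  shows "kappa R G H K L M \<in> carrier R"
proof -
  interpret cring R by fact
  show ?thesis using assms(2) unfolding kappa_def by (intro m_closed add.nat_pow_closed) auto
qed

lemma kappa_coeff_closed:
  assumes "cring R" "[order H] \<cdot>\<^bsub>R\<^esub> \<one>\<^bsub>R\<^esub> \<in> Units R"
  shows "kappa_coeff R G H K L M N \<in> carrier R"
proof -
  interpret cring R by fact
  show ?thesis unfolding kappa_coeff_def Let_def
    by (intro finsum_closed) (auto intro!: add.int_pow_closed kappa_closed assms)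
qed

lemma kappa_star_basis_closed:
  assumes "cring R" "[order H] \<cdot>\<^bsub>R\<^esub> \<one>\<^bsub>R\<^esub> \<in> Units R"
  shows "kappa_star_basis R G H K L M \<in> carrier (free_module R (subgroups_of (G \<times>\<times> K)))"
proof -
  interpret module R "free_module R (subgroups_of (G \<times>\<times> K))"
    by (rule free_module_module) fact
  show ?thesis unfolding kappa_star_basis_def Let_def
    by (intro M.finsum_closed) (auto intro!: smult_closed kappa_coeff_closed free_basis_closed assms)
qed

lemma kappa_star_free_basis:
  assumes "finite (carrier G)" "finite (carrier H)" "finite (carrier K)"
    and "cring R" "[order H] \<cdot>\<^bsub>R\<^esub> \<one>\<^bsub>R\<^esub> \<in> Units R"
    and "subgroup L (G \<times>\<times> H)" "subgroup M (H \<times>\<times> K)"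
  shows "kappa_star R G H K
           (free_basis R (subgroups_of (G \<times>\<times> H)) L) (free_basis R (subgroups_of (H \<times>\<times> K)) M)
         = kappa_star_basis R G H K L M"
proof -
  let ?F = "free_module R (subgroups_of (G \<times>\<times> K))"
  let ?A = "subgroups_of (G \<times>\<times> H)" and ?B = "subgroups_of (H \<times>\<times> K)"
  let ?k = "kappa_star_basis R G H K"
  interpret module R ?F
    by (rule free_module_module) fact
  note cl = kappa_star_basis_closed[OF assms(4,5)]
  have fin: "finite ?A" "finite ?B"
    using assms(1-3) by (auto simp: subgroups_of_def subgroup_def
        intro: finite_subset[of _ "Pow (carrier G \<times> carrier H)"]
          finite_subset[of _ "Pow (carrier H \<times> carrier K)"])
  have LM: "L \<in> ?A" "M \<in> ?B" using assms(6,7) by (auto simp: subgroups_of_def)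
  have null: "\<zero>\<^bsub>R\<^esub> \<odot>\<^bsub>?F\<^esub> ?k L' M' = \<zero>\<^bsub>?F\<^esub>" for L' M'
    by (rule smult_l_null[OF cl])
  have "kappa_star R G H K (free_basis R ?A L) (free_basis R ?B M)
      = (\<Oplus>\<^bsub>?F\<^esub>L'\<in>?A. \<Oplus>\<^bsub>?F\<^esub>M'\<in>?B. if M = M' then (if L = L' then ?k L' M' else \<zero>\<^bsub>?F\<^esub>) else \<zero>\<^bsub>?F\<^esub>)"
    unfolding kappa_star_def Let_def
    by (intro M.finsum_cong' refl)
      (auto simp: free_basis_def null cl intro!: M.finsum_closed)
  also have "\<dots> = (\<Oplus>\<^bsub>?F\<^esub>L'\<in>?A. if L = L' then ?k L' M else \<zero>\<^bsub>?F\<^esub>)"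
    using LM fin
    by (intro M.finsum_cong' refl M.finsum_singleton) (auto simp: cl)
  also have "\<dots> = ?k L M"
    using LM fin by (intro M.finsum_singleton) (auto simp: cl)
  finally show ?thesis .
qed
end

theory Submission
  imports Defs
begin

text \<open>
  Fix \<open>N\<close>. The coefficient of \<open>N\<close> in the product of \<open>L\<close> and \<open>M\<close> is the Moebius inverse, at \<open>(L, M)\<close>, of
  the function \<open>f\<close> on pairs of subgroups with \<open>f (L', M') = \<kappa>(L', M')\<close> if \<open>N \<subseteq> L' * M'\<close> and
  \<open>f (L', M') = 0\<close> otherwise. The value of \<open>f\<close> at a pair depends only on the elements \<open>(g, h) \<in> L'\<close>
  and \<open>(h, k) \<in> M'\<close> with \<open>g \<in> p1 N\<close>, \<open>h \<in> p2 L' \<inter> p1 M'\<close> and \<open>k \<in> p2 N\<close>, since no other element is seen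
  by \<open>N \<subseteq> L' * M'\<close> or by \<open>k2 L' \<inter> k1 M'\<close>. Hence \<open>f\<close> is unchanged by the order-preserving map \<open>\<phi>\<close>
  that discards all other elements of the two subgroups (\<open>trim\<close>).

  If \<open>f\<close> is invariant under an order-preserving map \<open>\<phi>\<close> with \<open>\<phi> x \<le> x\<close>, then its Moebius inverse
  vanishes at every \<open>y\<close> that \<open>\<phi>\<close> moves (\<open>moebius_inverse_eq_zero\<close>). So a nonzero coefficient forces
  \<open>\<phi>\<close> to fix \<open>(L, M)\<close>, which means \<open>p1 L \<subseteq> p1 N\<close>, \<open>p2 L = p1 M\<close> and \<open>p2 M \<subseteq> p2 N\<close>. It also
  forces \<open>N \<subseteq> L * M\<close>, as otherwise the defining sum is empty; this gives \<open>p1 N \<subseteq> p1 L\<close> and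
  \<open>p2 N \<subseteq> p2 M\<close> (\<open>kappa_coeff_nonzeroD\<close>).
\<close>

section \<open>Moebius inversion with values in an abelian group\<close>

context abelian_group
begin

lemma finsum_swap:
  assumes "finite A" "finite B" "\<And>a b. a \<in> A \<Longrightarrow> b \<in> B \<Longrightarrow> f a b \<in> carrier G"
  shows "(\<Oplus>a\<in>A. \<Oplus>b\<in>B. f a b) = (\<Oplus>b\<in>B. \<Oplus>a\<in>A. f a b)"
  using assms(1,3)
proof (induction A rule: finite_induct)
  case empty
  then show ?case by simp
next
  case (insert x A)
  have "(\<Oplus>a\<in>insert x A. \<Oplus>b\<in>B. f a b) = (\<Oplus>b\<in>B. f x b) \<oplus> (\<Oplus>b\<in>B. \<Oplus>a\<in>A. f a b)"
    using insert by (subst finsum_insert) (auto intro!: finsum_closed)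
  also have "\<dots> = (\<Oplus>b\<in>B. f x b \<oplus> (\<Oplus>a\<in>A. f a b))"
    using insert by (intro finsum_addf[symmetric]) (auto intro!: finsum_closed)
  also have "\<dots> = (\<Oplus>b\<in>B. \<Oplus>a\<in>insert x A. f a b)"
    using insert by (intro finsum_cong' refl) (auto intro!: finsum_closed)
  finally show ?case .
qed

lemma add_pow_zero_int: "[(0::int)] \<cdot> a = \<zero>"
  by (simp add: add_pow_def)

lemma finsum_add_pow_int:
  fixes n :: "'x \<Rightarrow> int"
  assumes "finite A" "a \<in> carrier G"
  shows "(\<Oplus>x\<in>A. [n x] \<cdot> a) = [(\<Sum>x\<in>A. n x)] \<cdot> a"
  using assms(1)
proof (induction A rule: finite_induct)
  case (insert x A)
  then show ?case
    using assms(2) by (simp add: add.int_pow_mult)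
qed (simp add: add_pow_zero_int)

definition moebius_inverse :: "'x::order set \<Rightarrow> ('x \<Rightarrow> 'a) \<Rightarrow> 'x \<Rightarrow> 'a" where
  "moebius_inverse P f y = (\<Oplus>x\<in>P. [moebius P x y] \<cdot> f x)"

lemma moebius_inverse_closed [intro, simp]:
  "f \<in> P \<rightarrow> carrier G \<Longrightarrow> moebius_inverse P f y \<in> carrier G"
  unfolding moebius_inverse_def by (intro finsum_closed) auto

text \<open>Interchanging the two summations turns the coefficient of \<open>f x\<close> into
  \<open>\<Sum>z\<le>y. moebius P x z\<close>, which is \<open>0\<close> unless \<open>x = y\<close>.\<close>

lemma finsum_moebius_inverse:
  assumes "finite P" "f \<in> P \<rightarrow> carrier G" "y \<in> P"
  shows "(\<Oplus>z\<in>{z\<in>P. z \<le> y}. moebius_inverse P f z) = f y"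
proof -
  have mu: "(\<Sum>z\<in>{z\<in>P. z \<le> y}. moebius P x z) = (if y = x then 1 else 0)" if "x \<in> P" for x
  proof -
    have "(\<Sum>z\<in>{z\<in>P. z \<le> y}. moebius P x z) = (\<Sum>z\<in>{z\<in>P. x \<le> z \<and> z \<le> y}. moebius P x z)"
      using assms(1) by (intro sum.mono_neutral_right) (auto intro: ccontr moebius_not_le)
    also have "\<dots> = (if y = x then 1 else 0)"
    proof (cases "x \<le> y")
      case True
      then show ?thesis using sum_moebius[OF assms(1) that assms(3)] by auto
    next
      case False
      then have "{z\<in>P. x \<le> z \<and> z \<le> y} = {}" using order_trans by blast
      then show ?thesis using False by (simp only: sum.empty) auto
    qed
    finally show ?thesis .
  qed
  have "(\<Oplus>z\<in>{z\<in>P. z \<le> y}. moebius_inverse P f z)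
      = (\<Oplus>x\<in>P. \<Oplus>z\<in>{z\<in>P. z \<le> y}. [moebius P x z] \<cdot> f x)"
    unfolding moebius_inverse_def using assms by (intro finsum_swap) auto
  also have "\<dots> = (\<Oplus>x\<in>P. if y = x then f x else \<zero>)"
  proof (intro finsum_cong' refl)
    fix x assume x: "x \<in> P"
    then have "f x \<in> carrier G" using assms(2) by (rule funcset_mem[rotated])
    then have "(\<Oplus>z\<in>{z\<in>P. z \<le> y}. [moebius P x z] \<cdot> f x)
        = [(\<Sum>z\<in>{z\<in>P. z \<le> y}. moebius P x z)] \<cdot> f x"
      using assms(1) by (intro finsum_add_pow_int) simp
    then show "(\<Oplus>z\<in>{z\<in>P. z \<le> y}. [moebius P x z] \<cdot> f x) = (if y = x then f x else \<zero>)"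
      using \<open>f x \<in> carrier G\<close> by (simp add: mu[OF x] add_pow_zero_int)
  qed (use assms(2) in auto)
  also have "\<dots> = f y"
    using assms by (intro finsum_singleton) auto
  finally show ?thesis .
qed

text \<open>Let \<open>g\<close> be the Moebius inverse of \<open>f\<close>. Comparing the inversion formulas at \<open>y\<close> and at \<open>\<phi> y\<close>, the
  equality \<open>f (\<phi> y) = f y\<close> says that \<open>g\<close> sums to \<open>0\<close> over the elements below \<open>y\<close> but not below
  \<open>\<phi> y\<close>. Each such \<open>z\<close> is moved by \<open>\<phi>\<close>, for \<open>z = \<phi> z\<close> would give \<open>z \<le> \<phi> y\<close>; so by induction
  \<open>g y\<close> is the only term that can be nonzero.\<close>

lemma moebius_inverse_eq_zero:
  assumes P: "finite P" and f: "f \<in> P \<rightarrow> carrier G" and \<phi>: "\<phi> \<in> P \<rightarrow> P" "mono_on P \<phi>"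
    and le: "\<And>x. x \<in> P \<Longrightarrow> \<phi> x \<le> x" and inv: "\<And>x. x \<in> P \<Longrightarrow> f (\<phi> x) = f x"
    and y: "y \<in> P" "\<phi> y \<noteq> y"
  shows "moebius_inverse P f y = \<zero>"
  using y
proof (induction "card {z\<in>P. z < y}" arbitrary: y rule: less_induct)
  case less
  let ?g = "moebius_inverse P f"
  let ?A = "{z\<in>P. z \<le> \<phi> y}" and ?B = "{z\<in>P. z \<le> y \<and> \<not> z \<le> \<phi> y}"
  have IH: "?g z = \<zero>" if "z \<in> ?B" "z \<noteq> y" for z
  proof (rule less.hyps)
    have "z < y" using that by auto
    then have "{w\<in>P. w < z} \<subset> {w\<in>P. w < y}" using that by auto
    then show "card {w\<in>P. w < z} < card {w\<in>P. w < y}"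
      using P by (intro psubset_card_mono) auto
    show "z \<in> P" using that by simp
    show "\<phi> z \<noteq> z" using that mono_onD[OF \<phi>(2), of z y] less.prems by auto
  qed
  have "y \<in> ?B" using less.prems le[of y] by auto
  have "f y = (\<Oplus>z\<in>{z\<in>P. z \<le> y}. ?g z)"
    using P f less.prems by (simp add: finsum_moebius_inverse)
  also have "{z\<in>P. z \<le> y} = ?A \<union> ?B"
    using le[of y] less.prems by auto
  also have "(\<Oplus>z\<in>?A \<union> ?B. ?g z) = (\<Oplus>z\<in>?A. ?g z) \<oplus> (\<Oplus>z\<in>?B. ?g z)"
    using P f by (intro finsum_Un_disjoint) auto
  also have "(\<Oplus>z\<in>?A. ?g z) = f y"
    using finsum_moebius_inverse[OF P f, of "\<phi> y"] \<phi>(1) inv less.prems by auto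
  also have "(\<Oplus>z\<in>?B. ?g z) = (\<Oplus>z\<in>?B. if y = z then ?g z else \<zero>)"
    using f IH by (intro finsum_cong' refl) auto
  also have "\<dots> = ?g y"
    using P f \<open>y \<in> ?B\<close> by (intro finsum_singleton) auto
  finally have "f y = f y \<oplus> ?g y" .
  moreover have "f y \<in> carrier G" "?g y \<in> carrier G"
    using f less.prems by auto
  ultimately show ?case
    using add.l_cancel_one' by blast
qed

end

section \<open>Trimming a pair of subgroups\<close>

lemma finite_subgroups_of: "finite (carrier G) \<Longrightarrow> finite (subgroups_of G)"
  by (rule finite_subset[of _ "Pow (carrier G)"]) (auto simp: subgroups_of_def subgroup_def)

lemma subgroup_p1:
  assumes "group G" "group H" "subgroup L (G \<times>\<times> H)"
  shows "subgroup (p1 L) G"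
proof -
  have "group_hom (G \<times>\<times> H) G fst"
    using assms(1,2)
    by (intro group_hom.intro group_hom_axioms.intro DirProd_group) (auto simp: hom_def)
  then show ?thesis using assms(3) by (rule group_hom.subgroup_img_is_subgroup)
qed

lemma subgroup_p2:
  assumes "group G" "group H" "subgroup L (G \<times>\<times> H)"
  shows "subgroup (p2 L) H"
proof -
  have "group_hom (G \<times>\<times> H) H snd"
    using assms(1,2)
    by (intro group_hom.intro group_hom_axioms.intro DirProd_group) (auto simp: hom_def)
  then show ?thesis using assms(3) by (rule group_hom.subgroup_img_is_subgroup)
qed

lemma subgroup_Int_Times:
  assumes "group G" "group H" "subgroup L (G \<times>\<times> H)" "subgroup A G" "subgroup B H"
  shows "subgroup (L \<inter> A \<times> B) (G \<times>\<times> H)"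
  using assms by (intro group.subgroups_Inter_pair DirProd_group DirProd_subgroups)

text \<open>Each of the two subgroups is cut down against the untrimmed other one. Cutting \<open>L\<close> down to
  \<open>p1 N\<close> may shrink \<open>p2 L\<close>, so trimming a second time can remove more; this is why
  \<open>moebius_inverse_eq_zero\<close> is stated for maps that may fail to be idempotent.\<close>

definition trim ::
  "('a \<times> 'c) set \<Rightarrow> ('a \<times> 'b) set \<times> ('b \<times> 'c) set \<Rightarrow> ('a \<times> 'b) set \<times> ('b \<times> 'c) set" where
  "trim N = (\<lambda>(L, M). (L \<inter> p1 N \<times> p1 M, M \<inter> p2 L \<times> p2 N))"

lemma trim_closed:
  assumes "group G" "group H" "group K" "subgroup N (G \<times>\<times> K)"
  shows "trim N \<in> subgroups_of (G \<times>\<times> H) \<times> subgroups_of (H \<times>\<times> K)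
    \<rightarrow> subgroups_of (G \<times>\<times> H) \<times> subgroups_of (H \<times>\<times> K)"
proof -
  note N = subgroup_p1[OF assms(1,3,4)] subgroup_p2[OF assms(1,3,4)]
  note LM = subgroup_p2[OF assms(1,2)] subgroup_p1[OF assms(2,3)]
  show ?thesis
    by (simp add: Pi_def trim_def subgroups_of_def subgroup_Int_Times assms N LM)
qed

lemma trim_le: "trim N x \<le> x"
  by (auto simp: trim_def split: prod.split)

lemma mono_trim: "mono (trim N)"
proof (rule monoI)
  fix x y :: "('a \<times> 'b) set \<times> ('b \<times> 'c) set"
  assume le: "x \<le> y"
  obtain L M L' M' where [simp]: "x = (L, M)" "y = (L', M')" by (cases x, cases y)
  have "L \<subseteq> L'" "M \<subseteq> M'" using le by auto
  then have "p1 M \<subseteq> p1 M'" "p2 L \<subseteq> p2 L'" by (auto simp: image_mono)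
  with \<open>L \<subseteq> L'\<close> \<open>M \<subseteq> M'\<close> show "trim N x \<le> trim N y"
    unfolding trim_def by auto
qed

lemma trim_fixed_iff:
  "trim N (L, M) = (L, M) \<longleftrightarrow> p1 L \<subseteq> p1 N \<and> p2 L = p1 M \<and> p2 M \<subseteq> p2 N"
proof -
  have times: "X \<inter> A \<times> B = X \<longleftrightarrow> p1 X \<subseteq> A \<and> p2 X \<subseteq> B"
    for X :: "('x \<times> 'y) set" and A B
    by force
  show ?thesis by (auto simp: trim_def times)
qed

lemma subset_relcomp_trim_iff:
  "N \<subseteq> fst (trim N (L, M)) O snd (trim N (L, M)) \<longleftrightarrow> N \<subseteq> L O M"
proof
  assume "N \<subseteq> L O M"
  show "N \<subseteq> fst (trim N (L, M)) O snd (trim N (L, M))"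
  proof
    fix n assume n: "n \<in> N"
    obtain g k where gk: "n = (g, k)" by (cases n)
    then obtain h where "(g, h) \<in> L" "(h, k) \<in> M" using n \<open>N \<subseteq> L O M\<close> by blast
    then show "n \<in> fst (trim N (L, M)) O snd (trim N (L, M))"
      using n unfolding gk trim_def by (force intro!: relcompI[of g h])
  qed
qed (auto simp: trim_def)

text \<open>An \<open>h\<close> counted by \<open>\<kappa>\<close> comes with \<open>(\<one>, h) \<in> L\<close> and \<open>(h, \<one>) \<in> M\<close>, and trimming keeps both
  because \<open>N\<close> contains the identity.\<close>

lemma kappa_trim:
  assumes "group G" "group K" "subgroup N (G \<times>\<times> K)"
  shows "kappa R G H K (fst (trim N (L, M))) (snd (trim N (L, M))) = kappa R G H K L M"
proof -
  have "(\<one>\<^bsub>G\<^esub>, \<one>\<^bsub>K\<^esub>) \<in> N"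
    using subgroup.one_closed[OF assms(3)] by simp
  then have "k2 G H (fst (trim N (L, M))) \<inter> k1 H K (snd (trim N (L, M))) = k2 G H L \<inter> k1 H K M"
    unfolding k1_def k2_def trim_def by force
  then show ?thesis by (simp add: kappa_def)
qed

section \<open>Vanishing of the coefficients\<close>

lemma kappa_coeff_nonzeroD:
  fixes G :: "('a, 'm) monoid_scheme" and H :: "('b, 'n) monoid_scheme"
    and K :: "('c, 'k) monoid_scheme" and R :: "('r, 's) ring_scheme"
  assumes fin: "finite (carrier G)" "finite (carrier H)" "finite (carrier K)"
    and grp: "group G" "group H" "group K"
    and R: "cring R" "[order H] \<cdot>\<^bsub>R\<^esub> \<one>\<^bsub>R\<^esub> \<in> Units R"
    and LM: "subgroup L (G \<times>\<times> H)" "subgroup M (H \<times>\<times> K)" and N: "subgroup N (G \<times>\<times> K)"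
    and nz: "kappa_coeff R G H K L M N \<noteq> \<zero>\<^bsub>R\<^esub>"
  shows "p1 N = p1 L" "p2 N = p2 M" "p2 L = p1 M"
proof -
  interpret cring R by fact
  let ?P = "subgroups_of (G \<times>\<times> H) \<times> subgroups_of (H \<times>\<times> K)"
  define f where "f = (\<lambda>(L', M'). if N \<subseteq> L' O M' then kappa R G H K L' M' else \<zero>\<^bsub>R\<^esub>)"
  note cl = kappa_closed[OF R]
  have P: "finite ?P"
    using fin by (intro finite_cartesian_product finite_subgroups_of) (auto simp: DirProd_def)
  have f: "f \<in> ?P \<rightarrow> carrier R" by (auto simp: f_def cl)
  have inv: "f (trim N x) = f x" for x
    by (cases x)
      (simp add: f_def case_prod_unfold kappa_trim[OF grp(1,3) N] subset_relcomp_trim_iff)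
  have "(L, M) \<in> ?P" using LM by (simp add: subgroups_of_def)
  then have van: "moebius_inverse ?P f (L, M) = \<zero>\<^bsub>R\<^esub>" if "trim N (L, M) \<noteq> (L, M)"
    using that
    by (rule moebius_inverse_eq_zero[OF P f trim_closed[OF grp N]
          mono_on_subset[OF mono_trim subset_UNIV] trim_le inv])
  have "kappa_coeff R G H K L M N = moebius_inverse ?P f (L, M)"
    unfolding kappa_coeff_def moebius_inverse_def Let_def
  proof (rule add.finprod_mono_neutral_cong_left)
    show "(\<lambda>x. [moebius ?P x (L, M)] \<cdot>\<^bsub>R\<^esub> f x) \<in> ?P \<rightarrow> carrier R"
      using f by (intro Pi_I add.int_pow_closed) (rule funcset_mem)
  next
    fix x
    assume "x \<in> ?P - {(L', M') \<in> ?P. (L', M') \<le> (L, M) \<and> N \<subseteq> L' O M'}"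
    then have "\<not> x \<le> (L, M) \<or> f x = \<zero>\<^bsub>R\<^esub>"
      by (cases x) (simp add: f_def)
    then show "[moebius ?P x (L, M)] \<cdot>\<^bsub>R\<^esub> f x = \<zero>\<^bsub>R\<^esub>"
      by (auto simp: moebius_not_le add_pow_zero_int)
  qed (use P in \<open>simp_all add: subset_iff f_def case_prod_unfold\<close>)
  with van nz have fixed: "trim N (L, M) = (L, M)" by argo
  have "N \<subseteq> L O M"
  proof (rule ccontr)
    assume not: "\<not> N \<subseteq> L O M"
    have "\<not> N \<subseteq> L' O M'" if "(L', M') \<le> (L, M)" for L' M'
      using not that relcomp_mono[of L' L M' M] by auto
    then have "{(L', M') \<in> ?P. (L', M') \<le> (L, M) \<and> N \<subseteq> L' O M'} = {}"
      by blast
    then show False using nz unfolding kappa_coeff_def Let_def by (simp only: finsum_empty simp_thms)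
  qed
  then have "p1 N \<subseteq> p1 (L O M)" "p2 N \<subseteq> p2 (L O M)"
    by (rule image_mono)+
  then have "p1 N \<subseteq> p1 L" "p2 N \<subseteq> p2 M" by force+
  then show "p1 N = p1 L" "p2 N = p2 M" "p2 L = p1 M"
    using fixed unfolding trim_fixed_iff by auto
qed

theorem corollary4p3:
  fixes G :: "('a, 'm) monoid_scheme"
    and H :: "('b, 'n) monoid_scheme"
    and K :: "('c, 'k) monoid_scheme"
    and R :: "('r, 's) ring_scheme"
    and L :: "('a \<times> 'b) set"
    and M :: "('b \<times> 'c) set"
  defines "F \<equiv> free_module R (subgroups_of (G \<times>\<times> K))"
    and "LM \<equiv> kappa_star R G H K
          (free_basis R (subgroups_of (G \<times>\<times> H)) L) (free_basis R (subgroups_of (H \<times>\<times> K)) M)"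
  assumes "group G" "finite (carrier G)"
    and "group H" "finite (carrier H)"
    and "group K" "finite (carrier K)"
    and "cring R" "[order H] \<cdot>\<^bsub>R\<^esub> \<one>\<^bsub>R\<^esub> \<in> Units R"
    and "subgroup L (G \<times>\<times> H)" "subgroup M (H \<times>\<times> K)"
  shows "(\<exists>c. (\<forall>N\<in>{N. subgroup N (G \<times>\<times> K) \<and> p1 N = p1 L \<and> p2 N = p2 M}. c N \<in> carrier R) \<and>
            LM = (\<Oplus>\<^bsub>F\<^esub>N\<in>{N. subgroup N (G \<times>\<times> K) \<and> p1 N = p1 L \<and> p2 N = p2 M}.
                    c N \<odot>\<^bsub>F\<^esub> free_basis R (subgroups_of (G \<times>\<times> K)) N)) \<and>
         (p2 L \<noteq> p1 M \<longrightarrow> LM = \<zero>\<^bsub>F\<^esub>)"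
proof -
  let ?B = "subgroups_of (G \<times>\<times> K)"
  let ?S = "{N. subgroup N (G \<times>\<times> K) \<and> p1 N = p1 L \<and> p2 N = p2 M}"
  let ?a = "kappa_coeff R G H K L M"
  interpret module R F
    unfolding F_def by (rule free_module_module) fact
  have fin: "finite ?B"
    using assms(4,8) by (intro finite_subgroups_of) (auto simp: DirProd_def)
  have a: "?a N \<in> carrier R" for N
    using assms(9,10) by (rule kappa_coeff_closed)
  have e: "free_basis R ?B N \<in> carrier F" for N
    unfolding F_def by (rule free_basis_closed) fact
  note nonzeroD = kappa_coeff_nonzeroD[OF assms(4,6,8,3,5,7,9-12)]
  have LM: "LM = (\<Oplus>\<^bsub>F\<^esub>N\<in>?B. ?a N \<odot>\<^bsub>F\<^esub> free_basis R ?B N)"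
    using kappa_star_free_basis[OF assms(4,6,8,9-12)]
    unfolding LM_def F_def kappa_star_basis_def Let_def .
  also have "\<dots> = (\<Oplus>\<^bsub>F\<^esub>N\<in>?S. ?a N \<odot>\<^bsub>F\<^esub> free_basis R ?B N)"
  proof (rule M.add.finprod_mono_neutral_cong_right)
    fix N assume "N \<in> ?B - ?S"
    then have "?a N = \<zero>\<^bsub>R\<^esub>"
      using nonzeroD(1,2)[of N] by (auto simp: subgroups_of_def)
    then show "?a N \<odot>\<^bsub>F\<^esub> free_basis R ?B N = \<zero>\<^bsub>F\<^esub>"
      using e by (simp add: smult_l_null)
  next
    show "(\<lambda>N. ?a N \<odot>\<^bsub>F\<^esub> free_basis R ?B N) \<in> ?B \<rightarrow> carrier F"
      using a e by (intro Pi_I smult_closed)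
  qed (use fin in \<open>auto simp only: subgroups_of_def\<close>)
  finally have support: "LM = (\<Oplus>\<^bsub>F\<^esub>N\<in>?S. ?a N \<odot>\<^bsub>F\<^esub> free_basis R ?B N)" .
  have zero: "LM = \<zero>\<^bsub>F\<^esub>" if "p2 L \<noteq> p1 M"
    unfolding LM
  proof (rule M.add.finprod_one_eqI)
    fix N assume "N \<in> ?B"
    then have "?a N = \<zero>\<^bsub>R\<^esub>"
      using nonzeroD(3)[of N] that by (auto simp: subgroups_of_def)
    then show "?a N \<odot>\<^bsub>F\<^esub> free_basis R ?B N = \<zero>\<^bsub>F\<^esub>"
      using e by (simp add: smult_l_null)
  qed
  show ?thesis
    by (intro conjI exI[of _ ?a] ballI impI) (rule a, rule support, rule zero)
qed

end
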